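(* Let $p$ be a prime, $R\ge1$, and let $k\ge 2$ be an integer with $k\mid(p-1)$ such that, if $p$ is odd, $2k\mid(p^R-1)$. Let $\omega$ be a primitive element of $\mathbb{F}_{p^R}$ and $\Gamma=\mathrm{GPaley}(p^R,\frac{p^R-1}{k})$. Then $\Gamma$ is connected and $\mathrm{Aut}(\Gamma)=T\rtimes\langle\widehat{\omega}^k,\alpha\rangle\le A\Gamma L(1,p^R)$.
   Context: $\mathrm{GPaley}(p^R,\frac{p^R-1}{k})$ is the Cayley graph on the additive group $V=\mathbb{F}_{p^R}$ with connection set $S=\{\omega^{jk}:j\ge0\}$ ($\{u,v\}$ an edge iff $v-u\in S$). $T$ is the group of translations $v\mapsto v+x$ ($x\in V$), $\widehat{\omega}^k$ is the map $x\mapsto x\omega^k$, and $\alpha$ is the Frobenius automorphism $x\mapsto x^p$ of $\mathbb{F}_{p^R}$; $A\Gamma L(1,p^R)=T\rtimes\langle\widehat{\omega},\alpha\rangle$. *)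

theory Defs
  imports
    "HOL-Algebra.Bij"
    "HOL-Algebra.Generated_Groups"
    "HOL-Library.Cardinality"
    "HOL-Number_Theory.Residues"
    "Graph_Theory.Graph_Theory"
begin

definition primitive_element :: "'a::field \<Rightarrow> bool" where
  "primitive_element \<omega> \<longleftrightarrow> range (\<lambda>j::nat. \<omega> ^ j) = UNIV - {0}"

text \<open>Undirected graphs are symmetric digraphs, as in the theory of pair graphs; an edge
  \<open>{u, v}\<close> is the pair of arcs \<open>(u, v)\<close> and \<open>(v, u)\<close>.\<close>

definition cayley_graph :: "'a::ab_group_add set \<Rightarrow> 'a pair_pre_digraph" where
  "cayley_graph S = \<lparr>pverts = UNIV, parcs = {(u, v). v - u \<in> S}\<rparr>"

text \<open>For a primitive element \<open>\<omega>\<close> of a field with \<open>q\<close> elements and \<open>k\<close> dividing \<open>q - 1\<close> this is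
  \<open>GPaley(q, (q - 1) / k)\<close>.\<close>

definition GPaley :: "'a::field \<Rightarrow> nat \<Rightarrow> 'a pair_pre_digraph" where
  "GPaley \<omega> k = cayley_graph {\<omega> ^ (j * k) | j::nat. True}"

definition graph_Aut :: "'a pair_pre_digraph \<Rightarrow> ('a \<Rightarrow> 'a) set" where
  "graph_Aut G = {f \<in> Bij (pverts G).
     \<forall>u\<in>pverts G. \<forall>v\<in>pverts G. (f u, f v) \<in> parcs G \<longleftrightarrow> (u, v) \<in> parcs G}"

definition internal_semidirect ::
    "('a, 'b) monoid_scheme \<Rightarrow> 'a set \<Rightarrow> 'a set \<Rightarrow> 'a set \<Rightarrow> bool" where
  "internal_semidirect G K N H \<longleftrightarrow>
     subgroup K G \<and> N \<lhd> G\<lparr>carrier := K\<rparr> \<and> subgroup H (G\<lparr>carrier := K\<rparr>) \<and>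
     N \<inter> H = {\<one>\<^bsub>G\<^esub>} \<and> N <#>\<^bsub>G\<^esub> H = K"

definition translation_group :: "('a::ab_group_add \<Rightarrow> 'a) set" where
  "translation_group = {(\<lambda>v. v + x) | x. True}"

definition mult_map :: "'a::field \<Rightarrow> 'a \<Rightarrow> 'a" where
  "mult_map c = (\<lambda>x. x * c)"

definition frobenius :: "nat \<Rightarrow> 'a::field \<Rightarrow> 'a" where
  "frobenius p = (\<lambda>x. x ^ p)"

text \<open>The one-dimensional affine semilinear group, for a primitive element \<open>\<omega>\<close> of a finite field
  of characteristic \<open>p\<close>.\<close>

definition AGammaL1 :: "nat \<Rightarrow> 'a::field \<Rightarrow> ('a \<Rightarrow> 'a) set" where
  "AGammaL1 p \<omega> = translation_group <#>\<^bsub>BijGroup UNIV\<^esub>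
     generate (BijGroup UNIV) {mult_map \<omega>, frobenius p}"

lemma BijGroup_UNIV_simps:
  "carrier (BijGroup UNIV) = {f. bij f}"
  "\<one>\<^bsub>BijGroup UNIV\<^esub> = (\<lambda>x. x)"
  "bij f \<Longrightarrow> bij g \<Longrightarrow> f \<otimes>\<^bsub>BijGroup UNIV\<^esub> g = f \<circ> g"
  by (auto simp: BijGroup_def Bij_def compose_def extensional_def restrict_def fun_eq_iff)

lemma inv_BijGroup_UNIV:
  assumes "bij f"
  shows "inv\<^bsub>BijGroup UNIV\<^esub> f = inv_into UNIV f"
proof -
  interpret group "BijGroup (UNIV :: 'a set)" by (rule group_BijGroup)
  show ?thesis
    using assms
    by (intro inv_equality)
      (auto simp: BijGroup_UNIV_simps bij_imp_bij_inv fun_eq_iff bij_is_inj)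
qed

lemma frobenius_finite_field:
  fixes x y :: "'a::{field,finite}"
  assumes "prime p" "CARD('a) = p ^ R"
  shows "CHAR('a) = p" "bij (frobenius p :: 'a \<Rightarrow> 'a)"
    "frobenius p (x + y) = frobenius p x + frobenius p y"
proof -
  have pr: "prime CHAR('a)"
    by (simp add: finite_imp_CHAR_pos prime_CHAR_semidom)
  show C: "CHAR('a) = p"
    using CHAR_dvd_CARD[where 'a='a] pr assms
    by (metis prime_dvd_power primes_dvd_imp_eq)
  have add: "frobenius p (x + y) = frobenius p x + frobenius p y" for x y :: 'a
    using pr C by (simp add: frobenius_def freshmans_dream)
  have "inj (frobenius p :: 'a \<Rightarrow> 'a)"
  proof (rule injI)
    fix x y :: 'a
    assume "frobenius p x = frobenius p y"
    with add[of "x - y" y] have "frobenius p (x - y) = 0" by simp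
    then show "x = y" by (simp add: frobenius_def)
  qed
  then show "bij (frobenius p :: 'a \<Rightarrow> 'a)"
    by (simp add: finite_UNIV_inj_surj bij_def)
  show "frobenius p (x + y) = frobenius p x + frobenius p y" by (rule add)
qed

lemma bij_mult_map: "c \<noteq> 0 \<Longrightarrow> bij (mult_map c)"
  unfolding mult_map_def
  by (rule bij_betw_byWitness[where f' = "\<lambda>x. x / c"]) auto

lemma bij_translation: "bij (\<lambda>v::'a::ab_group_add. v + x)"
  by (rule bij_betw_byWitness[where f' = "\<lambda>v. v - x"]) auto

lemma generate_additive:
  fixes A :: "('a::ab_group_add \<Rightarrow> 'a) set"
  assumes "\<And>f. f \<in> A \<Longrightarrow> bij f" "\<And>f x y. f \<in> A \<Longrightarrow> f (x + y) = f x + f y"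
    and "h \<in> generate (BijGroup UNIV) A"
  shows "bij h \<and> (\<forall>x y. h (x + y) = h x + h y)"
  using assms(3)
proof (induction rule: generate.induct)
  case one
  then show ?case using bij_id by (simp add: BijGroup_UNIV_simps id_def)
next
  case (incl h)
  with assms show ?case by blast
next
  case (inv h)
  then have b: "bij h" and a: "\<And>x y. h (x + y) = h x + h y" using assms by blast+
  have "inv_into UNIV h (x + y) = inv_into UNIV h x + inv_into UNIV h y" for x y
    using a[of "inv_into UNIV h x" "inv_into UNIV h y"] b
    by (metis bij_inv_eq_iff)
  with b show ?case by (simp add: inv_BijGroup_UNIV bij_imp_bij_inv)
next
  case (eng f g)
  then show ?case using bij_comp[of g f] by (simp add: BijGroup_UNIV_simps comp_def)
qed

lemma internal_semidirect_translation_group: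
  fixes H :: "('a::ab_group_add \<Rightarrow> 'a) set"
  assumes H: "subgroup H (BijGroup UNIV)"
    and add: "\<And>h x y. h \<in> H \<Longrightarrow> h (x + y) = h x + h y"
  shows "internal_semidirect (BijGroup UNIV)
           (translation_group <#>\<^bsub>BijGroup UNIV\<^esub> H) translation_group H"
proof -
  let ?G = "BijGroup (UNIV :: 'a set)"
  let ?K = "translation_group <#>\<^bsub>?G\<^esub> H"
  interpret G: group ?G by (rule group_BijGroup)
  have bH: "bij h" if "h \<in> H" for h
    using subgroup.mem_carrier[OF H that] by (simp add: BijGroup_UNIV_simps)
  have T: "subgroup translation_group ?G"
  proof (rule G.subgroupI)
    show "translation_group \<subseteq> carrier ?G"
      by (auto simp: translation_group_def BijGroup_UNIV_simps bij_translation)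
    show "translation_group \<noteq> ({} :: ('a \<Rightarrow> 'a) set)" by (auto simp: translation_group_def)
  next
    fix f :: "'a \<Rightarrow> 'a" assume "f \<in> translation_group"
    then obtain x where f: "f = (\<lambda>v. v + x)" by (auto simp: translation_group_def)
    have "inv\<^bsub>?G\<^esub> f = (\<lambda>v. v + (- x))"
      unfolding f by (rule G.inv_equality)
        (use bij_translation[of x] bij_translation[of "-x"] in
          \<open>auto simp: BijGroup_UNIV_simps fun_eq_iff\<close>)
    then show "inv\<^bsub>?G\<^esub> f \<in> translation_group" unfolding translation_group_def by blast
  next
    fix f g :: "'a \<Rightarrow> 'a" assume "f \<in> translation_group" "g \<in> translation_group"
    then obtain x y where fg: "f = (\<lambda>v. v + x)" "g = (\<lambda>v. v + y)"
      by (auto simp: translation_group_def)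
    have "f \<otimes>\<^bsub>?G\<^esub> g = (\<lambda>v. v + (y + x))"
      unfolding fg by (simp add: BijGroup_UNIV_simps(3) bij_translation comp_def add.assoc)
    then show "f \<otimes>\<^bsub>?G\<^esub> g \<in> translation_group" unfolding translation_group_def by blast
  qed
  have Hinv: "inv_into UNIV h \<in> H" if "h \<in> H" for h
    using subgroup.m_inv_closed[OF H that] inv_BijGroup_UNIV[OF bH[OF that]] by simp
  have Hcomp: "h \<circ> h' \<in> H" if "h \<in> H" "h' \<in> H" for h h'
    using subgroup.m_closed[OF H that] bH that by (simp add: BijGroup_UNIV_simps)
  have Hid: "(\<lambda>x. x) \<in> H"
    using subgroup.one_closed[OF H] by (simp add: BijGroup_UNIV_simps)
  have H0: "h 0 = 0" if "h \<in> H" for h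
    using add[OF that, of 0 0] by simp
  have prod: "(\<lambda>v. v + x) \<otimes>\<^bsub>?G\<^esub> h = (\<lambda>v. h v + x)" if "h \<in> H" for h x
    using bH[OF that] by (simp add: BijGroup_UNIV_simps bij_translation fun_eq_iff)
  have Kiff: "f \<in> ?K \<longleftrightarrow> (\<exists>h\<in>H. \<exists>x. f = (\<lambda>v. h v + x))" for f
  proof
    assume "f \<in> ?K"
    then obtain h x where "h \<in> H" "f = (\<lambda>v. v + x) \<otimes>\<^bsub>?G\<^esub> h"
      by (auto simp: set_mult_def translation_group_def)
    then show "\<exists>h\<in>H. \<exists>x. f = (\<lambda>v. h v + x)" using prod by blast
  next
    assume "\<exists>h\<in>H. \<exists>x. f = (\<lambda>v. h v + x)"
    then obtain h x where "h \<in> H" "f = (\<lambda>v. v + x) \<otimes>\<^bsub>?G\<^esub> h" using prod by metis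
    then show "f \<in> ?K" unfolding set_mult_def translation_group_def by blast
  qed
  have Kbij: "bij f" if "f \<in> ?K" for f
  proof -
    from that obtain h x where h: "h \<in> H" "f = (\<lambda>v. h v + x)" using Kiff by blast
    then have "f = (\<lambda>v. v + x) \<circ> h" by (simp add: fun_eq_iff)
    then show ?thesis using bij_comp[OF bH[OF h(1)] bij_translation[of x]] by simp
  qed
  have K: "subgroup ?K ?G"
  proof (rule G.subgroupI)
    show "?K \<subseteq> carrier ?G" using Kbij by (auto simp: BijGroup_UNIV_simps)
    show "?K \<noteq> {}" using Kiff Hid by blast
  next
    fix f assume f: "f \<in> ?K"
    then obtain h x where h: "h \<in> H" "f = (\<lambda>v. h v + x)" using Kiff by blast
    let ?h = "inv_into UNIV h" and ?g = "\<lambda>v. inv_into UNIV h v + inv_into UNIV h (- x)"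
    have g: "?g \<in> ?K" using Kiff Hinv[OF h(1)] by blast
    have "?g (f v) = v" for v
    proof -
      have "?g (f v) = ?h (h v + x + - x)"
        unfolding h(2) by (rule add[OF Hinv[OF h(1)], symmetric])
      then show ?thesis using bH[OF h(1)] by (simp add: bij_is_inj)
    qed
    then have "inv\<^bsub>?G\<^esub> f = ?g"
      using Kbij[OF f] Kbij[OF g] by (intro G.inv_equality) (auto simp: BijGroup_UNIV_simps fun_eq_iff)
    with g show "inv\<^bsub>?G\<^esub> f \<in> ?K" by simp
  next
    fix f g assume fg: "f \<in> ?K" "g \<in> ?K"
    then obtain h x h' x' where h: "h \<in> H" "f = (\<lambda>v. h v + x)" "h' \<in> H" "g = (\<lambda>v. h' v + x')"
      using Kiff by blast
    have "f \<otimes>\<^bsub>?G\<^esub> g = (\<lambda>v. (h \<circ> h') v + (h x' + x))"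
      using Kbij[OF fg(1)] Kbij[OF fg(2)] add[OF h(1)]
      by (simp add: BijGroup_UNIV_simps fun_eq_iff h(2,4) add.assoc)
    then show "f \<otimes>\<^bsub>?G\<^esub> g \<in> ?K" using Kiff Hcomp[OF h(1,3)] by blast
  qed
  have TK: "translation_group \<subseteq> ?K"
  proof
    fix t :: "'a \<Rightarrow> 'a" assume "t \<in> translation_group"
    then obtain x where "t = (\<lambda>v. v + x)" by (auto simp: translation_group_def)
    then show "t \<in> ?K" unfolding Kiff using Hid by (intro bexI[of _ "\<lambda>x. x"]) auto
  qed
  have HK: "H \<subseteq> ?K"
  proof
    fix h assume h: "h \<in> H"
    then have "h = (\<lambda>v. h v + 0)" by simp
    with h show "h \<in> ?K" unfolding Kiff by blast
  qed
  interpret K: group "?G\<lparr>carrier := ?K\<rparr>"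
    by (rule G.subgroup_imp_group[OF K])
  have "translation_group \<lhd> ?G\<lparr>carrier := ?K\<rparr>"
  proof (rule K.normal_invI)
    show "subgroup translation_group (?G\<lparr>carrier := ?K\<rparr>)"
      by (rule G.subgroup_incl[OF T K TK])
  next
    fix f t :: "'a \<Rightarrow> 'a" assume "f \<in> carrier (?G\<lparr>carrier := ?K\<rparr>)" and t: "t \<in> translation_group"
    then have f: "f \<in> ?K" by simp
    then obtain h x where h: "h \<in> H" "f = (\<lambda>v. h v + x)" using Kiff by blast
    from t obtain y where y: "t = (\<lambda>v. v + y)" by (auto simp: translation_group_def)
    have bt: "bij t" unfolding y by (rule bij_translation)
    note bf = Kbij[OF f]
    have "f (t (inv_into UNIV f v)) = v + h y" for v
    proof -
      have "f (t u) = f u + h y" for u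
        by (simp add: h(2) y add[OF h(1)] algebra_simps)
      then show ?thesis using bf by (simp add: bij_is_surj surj_f_inv_f)
    qed
    then have "f \<otimes>\<^bsub>?G\<^esub> t \<otimes>\<^bsub>?G\<^esub> inv\<^bsub>?G\<^esub> f = (\<lambda>v. v + h y)"
      using bf bt by (simp add: inv_BijGroup_UNIV BijGroup_UNIV_simps bij_comp bij_imp_bij_inv fun_eq_iff)
    then show "f \<otimes>\<^bsub>?G\<lparr>carrier := ?K\<rparr>\<^esub> t \<otimes>\<^bsub>?G\<lparr>carrier := ?K\<rparr>\<^esub> inv\<^bsub>?G\<lparr>carrier := ?K\<rparr>\<^esub> f \<in> translation_group"
      using G.m_inv_consistent[OF K f] by (auto simp: translation_group_def)
  qed
  moreover have "translation_group \<inter> H = {\<one>\<^bsub>?G\<^esub>}"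
  proof (intro equalityI subsetI)
    fix f assume "f \<in> translation_group \<inter> H"
    then obtain x where "f = (\<lambda>v. v + x)" "f \<in> H" by (auto simp: translation_group_def)
    with H0 show "f \<in> {\<one>\<^bsub>?G\<^esub>}" by (force simp: BijGroup_UNIV_simps)
  next
    fix f assume "f \<in> {\<one>\<^bsub>?G\<^esub>}"
    then show "f \<in> translation_group \<inter> H"
      using subgroup.one_closed[OF T] subgroup.one_closed[OF H] by auto
  qed
  ultimately show ?thesis
    unfolding internal_semidirect_def using K G.subgroup_incl[OF H K HK] by blast
qed

lemma internal_semidirect_AGammaL1:
  fixes \<omega> :: "'a::{field,finite}"
  assumes "prime p" "CARD('a) = p ^ R" "primitive_element \<omega>"
  shows "internal_semidirect (BijGroup UNIV) (AGammaL1 p \<omega>) translation_group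
           (generate (BijGroup UNIV) {mult_map \<omega>, frobenius p})"
proof -
  interpret G: group "BijGroup (UNIV :: 'a set)" by (rule group_BijGroup)
  let ?A = "{mult_map \<omega>, frobenius p}"
  have "\<omega> ^ 1 \<in> range (\<lambda>j::nat. \<omega> ^ j)" by blast
  then have "\<omega> \<noteq> 0" using assms(3) by (auto simp: primitive_element_def)
  then have b: "bij f" if "f \<in> ?A" for f
    using that bij_mult_map frobenius_finite_field(2)[OF assms(1,2)] by blast
  have a: "f (x + y) = f x + f y" if "f \<in> ?A" for f x y
    using that frobenius_finite_field(3)[OF assms(1,2)] by (auto simp: mult_map_def distrib_right)
  show ?thesis
    unfolding AGammaL1_def
  proof (rule internal_semidirect_translation_group)
    show "subgroup (generate (BijGroup UNIV) ?A) (BijGroup UNIV)"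
      using b by (intro G.generate_is_subgroup) (auto simp: BijGroup_UNIV_simps)
  qed (use generate_additive[of ?A] a b in blast)
qed

lemma pair_graph_GPaley:
  fixes \<omega> :: "'a::{field,finite}"
  assumes "CARD('a) = p ^ R" "2 * k dvd p ^ R - 1" "primitive_element \<omega>"
  shows "pair_graph (GPaley \<omega> k)"
proof -
  let ?S = "{\<omega> ^ (j * k) | j::nat. True}"
  have "\<omega> ^ 1 \<in> range (\<lambda>j::nat. \<omega> ^ j)" by blast
  then have w0: "\<omega> \<noteq> 0" using assms(3) by (auto simp: primitive_element_def)
  have card: "card (UNIV - {0::'a}) = p ^ R - 1"
    using assms(1) by (simp add: card_Diff_singleton)
  have one: "\<omega> ^ (p ^ R - 1) = 1"
  proof -
    have "bij_betw (mult_map \<omega>) (UNIV - {0}) (UNIV - {0})"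
      using w0 unfolding mult_map_def
      by (intro bij_betw_byWitness[where f' = "\<lambda>x. x / \<omega>"]) auto
    from prod.reindex_bij_betw[OF this, of "\<lambda>x. x"]
    have "(\<Prod>x\<in>UNIV - {0}. x * \<omega>) = \<Prod>(UNIV - {0})" by (simp add: mult_map_def)
    moreover have "\<Prod>(UNIV - {0::'a}) \<noteq> 0" by simp
    ultimately show ?thesis using card by (simp add: prod.distrib)
  qed
  obtain m where m: "p ^ R - 1 = 2 * k * m" using assms(2) by (auto elim: dvdE)
  have pos: "p ^ R - 1 > 0"
    using card card_gt_0_iff[of "UNIV - {0::'a}"] by (metis DiffI UNIV_I empty_iff finite singletonD zero_neq_one)
  define n where "n = m * k"
  have n: "p ^ R - 1 = 2 * n" "n > 0" using m pos by (auto simp: n_def intro: Nat.gr0I)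
  have "\<omega> ^ n \<noteq> 1"
  proof
    assume 1: "\<omega> ^ n = 1"
    have "range (\<lambda>j::nat. \<omega> ^ j) \<subseteq> (\<lambda>j. \<omega> ^ j) ` {..<n}"
    proof (intro image_subsetI)
      fix j :: nat
      have "\<omega> ^ j = \<omega> ^ (n * (j div n) + j mod n)" by simp
      also have "\<dots> = \<omega> ^ (j mod n)" unfolding power_add power_mult 1 by simp
      finally show "\<omega> ^ j \<in> (\<lambda>j. \<omega> ^ j) ` {..<n}" using n(2) by auto
    qed
    then have "card (UNIV - {0::'a}) \<le> card ((\<lambda>j. \<omega> ^ j) ` {..<n})"
      using assms(3) unfolding primitive_element_def by (metis card_mono finite)
    also have "\<dots> \<le> n" using card_image_le[of "{..<n}"] by simp
    finally show False using card n by simp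
  qed
  moreover have "(\<omega> ^ n)\<^sup>2 = 1"
    using one n(1) by (metis power_mult mult.commute)
  ultimately have neg1: "- 1 = \<omega> ^ (m * k)"
    by (simp add: power2_eq_1_iff n_def)
  have S_neg: "- s \<in> ?S" if s: "s \<in> ?S" for s
  proof -
    from s obtain j where "s = \<omega> ^ (j * k)" by auto
    then have "- s = (- 1) * \<omega> ^ (j * k)" by simp
    also have "\<dots> = \<omega> ^ ((m + j) * k)" unfolding neg1 by (simp add: power_add distrib_right)
    finally show ?thesis by blast
  qed
  show ?thesis
  proof unfold_locales
    show "symmetric (with_proj (GPaley \<omega> k))"
      unfolding symmetric_def sym_def
    proof (intro allI impI)
      fix u v assume "(u, v) \<in> arcs_ends (with_proj (GPaley \<omega> k))"
      then have "v - u \<in> ?S" by (simp add: GPaley_def cayley_graph_def)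
      from S_neg[OF this] show "(v, u) \<in> arcs_ends (with_proj (GPaley \<omega> k))"
        by (simp add: GPaley_def cayley_graph_def)
    qed
  qed (use w0 in \<open>auto simp: GPaley_def cayley_graph_def\<close>)
qed

end

theory Submission
  imports Defs "HOL-Computational_Algebra.Polynomial"
begin

text \<open>Put \<open>q = p\<^sup>R\<close>, \<open>N = (q - 1) / k\<close> and \<open>d = (p - 1) / k\<close>. All base-\<open>p\<close> digits of \<open>N\<close> are \<open>d\<close>,
  so by Lucas' theorem many binomial coefficients built from \<open>N\<close> are nonzero in the field, and the
  connection set is \<open>{x. x\<^sup>N = 1}\<close>.

  A kernel \<open>g (x - y)\<close> invariant under an automorphism \<open>f\<close> may be convolved with another one. Over
  the field itself, a power of \<open>x\<close> convolved with a power of \<open>x\<close> is a multiple of a power of \<open>x\<close>,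
  and the kernels \<open>x\<^sup>j\<^sup>N\<close> span a truncated polynomial algebra that is generated by the adjacency
  kernel. Hence \<open>x\<^sup>N\<close> is invariant: \<open>(f x - f y)\<^sup>N = (x - y)\<^sup>N\<close>.

  Normalise \<open>f 0 = 0\<close>. Expanding the left-hand side and integrating against powers of \<open>f y\<close> shows
  that \<open>f\<^sup>m\<close> is a polynomial of degree at most \<open>N\<close> whenever the binomial coefficient of \<open>N\<close> over
  \<open>m\<close> is nonzero. As \<open>2 N \<le> q - 1\<close>, a product of two such polynomials is determined by its values.
  So \<open>f \<cdot> f\<^sup>N\<^sup>-\<^sup>1 = x\<^sup>N\<close> holds for polynomials, which forces \<open>f = c x\<^sup>e\<close>, and the degree bounds for
  all \<open>f\<^sup>m\<close> together bound the base-\<open>p\<close> digit sum of \<open>e\<close> by 1, so that \<open>e\<close> is a power of \<open>p\<close>.\<close>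

subsection \<open>Binomial coefficients, polynomials and digits\<close>

text \<open>One step of Lucas' theorem: compare coefficients in
  \<open>(1 + X) ^ (p * A + B) = (1 + X ^ p) ^ A * (1 + X) ^ B\<close>. As \<open>B\<close> and
  \<open>D\<close> are below \<open>p\<close>, only the term \<open>X ^ (p * C)\<close> of the first
  factor contributes to the exponent \<open>p * C + D\<close>.\<close>

lemma binomial_mult_char:
  fixes p A B C D :: nat
  assumes p: "prime p" "CHAR('a::field) = p" and lt: "B < p" "D < p"
  shows "(of_nat (p * A + B choose (p * C + D)) :: 'a) = of_nat (A choose C) * of_nat (B choose D)"
proof -
  let ?L = "[:1, 1:] :: 'a poly"
  have cL: "coeff (?L ^ n) m = of_nat (n choose m)" for n m
    using coeff_linear_poly_power[of m n 1 "1::'a"]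
    by (cases "m \<le> n") (auto simp: coeff_eq_0 degree_linear_power binomial_eq_0)
  have L: "?L = monom 1 1 + 1"
    by (simp add: monom_altdef one_pCons)
  have "?L ^ p = monom 1 1 ^ p + 1 ^ p"
    unfolding L using p by (subst freshmans_dream) auto
  then have Lp: "?L ^ p = monom 1 p + 1"
    by (simp add: monom_power)
  have "?L ^ (p * A + B) = (monom 1 p + 1) ^ A * ?L ^ B"
    by (simp add: power_add power_mult Lp)
  also have "(monom 1 p + 1 :: 'a poly) ^ A = (\<Sum>i\<le>A. monom (of_nat (A choose i)) (p * i))"
    by (simp add: binomial_ring monom_power of_nat_poly smult_monom mult.commute)
  finally have eq: "?L ^ (p * A + B) = (\<Sum>i\<le>A. monom (of_nat (A choose i)) (p * i) * ?L ^ B)"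
    by (simp add: sum_distrib_right)
  have zero: "coeff (monom (of_nat (A choose i)) (p * i) * ?L ^ B) (p * C + D) = 0"
    if "i \<noteq> C" for i
  proof (cases "i < C")
    case True
    then obtain t where "C = i + Suc t" using less_imp_Suc_add by auto
    then have "p * C + D - p * i > B" using lt by (simp add: algebra_simps)
    then show ?thesis by (simp add: coeff_monom_mult cL binomial_eq_0)
  next
    case False
    with that obtain t where "i = C + Suc t" using less_imp_Suc_add[of C i] by auto
    then have "p * C + D < p * i" using lt by (simp add: algebra_simps)
    then show ?thesis by (simp add: coeff_monom_mult)
  qed
  have "of_nat (p * A + B choose (p * C + D)) = coeff (?L ^ (p * A + B)) (p * C + D)"
    by (simp add: cL)
  also have "\<dots> = (\<Sum>i\<le>A. coeff (monom (of_nat (A choose i)) (p * i) * ?L ^ B) (p * C + D))"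
    by (simp add: eq coeff_sum)
  also have "\<dots> = (\<Sum>i\<le>A. if i = C then of_nat (A choose C) * of_nat (B choose D) else 0)"
  proof (rule sum.cong)
    fix i
    show "coeff (monom (of_nat (A choose i)) (p * i) * ?L ^ B) (p * C + D) =
        (if i = C then of_nat (A choose C) * of_nat (B choose D) else 0)"
      using zero[of i] by (cases "i = C") (simp_all add: coeff_monom_mult cL)
  qed simp
  also have "\<dots> = of_nat (A choose C) * of_nat (B choose D)"
    by (auto simp: binomial_eq_0)
  finally show ?thesis .
qed

text \<open>Induction on the number of digits, splitting off the lowest one. The binomial
  coefficient of two digits \<open>a 0 \<le> b 0 < p\<close> divides \<open>fact (b 0)\<close>,
  which is prime to \<open>p\<close>.\<close>

lemma binomial_digits_nonzero:
  fixes p :: nat and a b :: "nat \<Rightarrow> nat"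
  assumes p: "prime p" "CHAR('a::field) = p" and ab: "\<And>l. l < R \<Longrightarrow> a l \<le> b l" "\<And>l. l < R \<Longrightarrow> b l < p"
  shows "(of_nat ((\<Sum>l<R. b l * p ^ l) choose (\<Sum>l<R. a l * p ^ l)) :: 'a) \<noteq> 0"
  using ab
proof (induction R arbitrary: a b)
  case 0
  then show ?case by simp
next
  case (Suc R)
  have split: "(\<Sum>l<Suc R. c l * p ^ l) = p * (\<Sum>l<R. c (Suc l) * p ^ l) + c 0" for c :: "nat \<Rightarrow> nat"
    unfolding sum.lessThan_Suc_shift by (simp add: sum_distrib_left mult_ac)
  have lt: "b 0 < p" "a 0 < p" "a 0 \<le> b 0"
    using Suc.prems(1)[of 0] Suc.prems(2)[of 0] by auto
  have "\<not> p dvd (b 0 choose a 0)"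
    using lt p(1) by (metis binomial_fact_lemma dvd_mult prime_dvd_fact_iff not_less)
  then have "(of_nat (b 0 choose a 0) :: 'a) \<noteq> 0"
    by (simp add: of_nat_eq_0_iff_char_dvd p)
  moreover have "(of_nat ((\<Sum>l<R. b (Suc l) * p ^ l) choose (\<Sum>l<R. a (Suc l) * p ^ l)) :: 'a) \<noteq> 0"
    using Suc.prems by (intro Suc.IH) auto
  ultimately show ?case
    unfolding split by (subst binomial_mult_char[OF p]) (use lt in auto)
qed

text \<open>The order at 0 never exceeds the degree, and both are additive over products. They agree
  for the monomial, hence for each factor.\<close>

lemma poly_mult_eq_monomD:
  fixes P Q :: "'a::idom poly"
  assumes "P * Q = monom 1 n"
  obtains c e where "P = monom c e" "c \<noteq> 0"
proof -
  have nz: "P * Q \<noteq> 0" "P \<noteq> 0" "Q \<noteq> 0" using assms by auto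
  have "order 0 P + order 0 Q = degree P + degree Q"
    using order_mult[OF nz(1), of 0] degree_mult_eq[OF nz(2,3)] assms
    by (simp add: order_0_monom degree_monom_eq)
  with order_degree[OF nz(2), of 0] order_degree[OF nz(3), of 0]
  have "degree P \<le> order 0 P" by simp
  then have "monom 1 (degree P) dvd P" using nz by (simp add: monom_1_dvd_iff)
  then have "coeff P i = 0" if "i < degree P" for i
    using that by (simp add: monom_1_dvd_iff')
  then have "P = monom (lead_coeff P) (degree P)"
    by (intro poly_eqI) (metis coeff_eq_0 coeff_monom linorder_neqE_nat)
  then show ?thesis using that nz(2) by (metis leading_coeff_0_iff)
qed

text \<open>The digit sum of \<open>e\<close> in base \<open>p\<close> is \<open>(p - 1) / (p\<^sup>R - 1)\<close> times the sum of the cyclic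
  shifts \<open>e p\<^sup>i mod (p\<^sup>R - 1)\<close>; here that digit sum is at most 1.\<close>

lemma cyclic_shift_sum_le_imp_power:
  fixes p R e :: nat
  assumes e: "0 < e" "e < p ^ R - 1"
    and le: "(p - 1) * (\<Sum>i<R. e * p ^ i mod (p ^ R - 1)) \<le> p ^ R - 1"
  obtains j where "e = p ^ j"
proof -
  define Q where "Q = p ^ R - 1"
  define E where "E i = e * p ^ i mod Q" for i
  \<comment> \<open>Long division of \<open>e\<close> by \<open>Q\<close> in base \<open>p\<close>,
    with remainders \<open>E i\<close> and quotients \<open>c i\<close>. Since
    \<open>E R = e\<close> closes the cycle, \<open>tel\<close> makes
    \<open>c 0, ..., c (R - 1)\<close> the base-\<open>p\<close> digits of \<open>e\<close>, highest
    first.\<close>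
  define c where "c i = p * E i div Q" for i
  have Q0: "Q > 0" using e by (simp add: Q_def)
  have pR: "p ^ R = Q + 1" using Q0 unfolding Q_def by simp
  have E0: "E 0 = e" using e by (simp add: E_def Q_def)
  have ER: "E R = e" using e by (simp add: E_def pR distrib_left Q_def[symmetric])
  have step: "E (Suc i) + Q * c i = p * E i" for i
  proof -
    have "E (Suc i) = p * E i mod Q"
      unfolding E_def by (simp add: mod_mult_right_eq mult_ac)
    then show ?thesis by (simp add: c_def)
  qed
  have tel: "E n + Q * (\<Sum>i<n. c i * p ^ (n - 1 - i)) = p ^ n * e" for n
  proof (induction n)
    case 0
    then show ?case by (simp add: E0)
  next
    case (Suc n)
    have "(\<Sum>i<n. c i * p ^ (n - i)) = p * (\<Sum>i<n. c i * p ^ (n - 1 - i))"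
      unfolding sum_distrib_left
    proof (rule sum.cong)
      fix i assume "i \<in> {..<n}"
      then have "n - i = Suc (n - 1 - i)" by auto
      then show "c i * p ^ (n - i) = p * (c i * p ^ (n - 1 - i))" by simp
    qed simp
    then have "E (Suc n) + Q * (\<Sum>i<Suc n. c i * p ^ (Suc n - 1 - i))
        = p * (E n + Q * (\<Sum>i<n. c i * p ^ (n - 1 - i)))"
      using step[of n] by (simp add: algebra_simps)
    then show ?case using Suc.IH by simp
  qed
  have "Q * (\<Sum>i<R. c i * p ^ (R - 1 - i)) = Q * e"
    using tel[of R] ER pR by (simp add: algebra_simps)
  then have e_eq: "e = (\<Sum>i<R. c i * p ^ (R - 1 - i))" using Q0 by simp
  \<comment> \<open>Summing \<open>step\<close> over one full cycle gives \<open>Q\<close> times the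
    digit sum as \<open>(p - 1)\<close> times the sum of the shifts.\<close>
  have "(\<Sum>i<R. E (Suc i)) = (\<Sum>i<R. E i)"
    using sum.lessThan_Suc_shift[of E R] sum.lessThan_Suc[of E R] E0 ER by simp
  moreover have "(\<Sum>i<R. E (Suc i)) + Q * (\<Sum>i<R. c i) = p * (\<Sum>i<R. E i)"
    by (simp add: sum_distrib_left sum.distrib[symmetric] step)
  ultimately have "Q * (\<Sum>i<R. c i) = (p - 1) * (\<Sum>i<R. E i)"
    by (simp add: algebra_simps)
  also have "\<dots> \<le> Q * 1" using le by (simp add: E_def Q_def)
  finally have c1: "(\<Sum>i<R. c i) \<le> 1" using Q0 by simp
  have "\<exists>j<R. c j \<noteq> 0"
  proof (rule ccontr)
    assume "\<not> (\<exists>j<R. c j \<noteq> 0)"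
    then have "(\<Sum>i<R. c i * p ^ (R - 1 - i)) = 0" by (intro sum.neutral) simp
    with e_eq e(1) show False by linarith
  qed
  then obtain j where j: "j < R" "c j \<noteq> 0" by blast
  have cs: "(\<Sum>i<R. c i) = c j + (\<Sum>i\<in>{..<R} - {j}. c i)"
    using j(1) by (intro sum.remove) auto
  then have cj: "c j = 1" and "(\<Sum>i\<in>{..<R} - {j}. c i) = 0" using c1 j(2) by linarith+
  then have other: "c i = 0" if "i \<in> {..<R} - {j}" for i using that by simp
  have "e = c j * p ^ (R - 1 - j) + (\<Sum>i\<in>{..<R} - {j}. c i * p ^ (R - 1 - i))"
    by (subst e_eq, rule sum.remove) (use j(1) in auto)
  also have "(\<Sum>i\<in>{..<R} - {j}. c i * p ^ (R - 1 - i)) = 0" using other by simp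
  finally have "e = p ^ (R - 1 - j)" using cj by simp
  then show ?thesis by (rule that)
qed

subsection \<open>Power sums and convolutions over a finite field\<close>

lemma power_card_minus_one:
  fixes x :: "'a::{field,finite}"
  assumes "x \<noteq> 0"
  shows "x ^ (CARD('a) - 1) = 1"
proof -
  have "bij_betw (\<lambda>y. y * x) (UNIV - {0}) (UNIV - {0})"
    using assms by (intro bij_betw_byWitness[where f' = "\<lambda>y. y / x"]) auto
  from prod.reindex_bij_betw[OF this, of "\<lambda>y. y"]
  have "(\<Prod>y\<in>UNIV - {0}. y * x) = \<Prod>(UNIV - {0})" .
  moreover have "\<Prod>(UNIV - {0::'a}) \<noteq> 0" by simp
  ultimately show ?thesis by (simp add: prod.distrib card_Diff_singleton)
qed

lemma primitive_element_nonzero: "primitive_element \<omega> \<Longrightarrow> \<omega> \<noteq> 0"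
  unfolding primitive_element_def by (metis DiffD2 power_one_right rangeI singletonI)

text \<open>If a positive remainder \<open>r < Q\<close> gave \<open>\<omega> ^ r = 1\<close>, the
  powers of \<open>\<omega>\<close> would take at most \<open>r\<close> values, too few for all
  nonzero elements.\<close>

lemma primitive_power_eq_1_iff:
  fixes \<omega> :: "'a::{field,finite}"
  assumes prim: "primitive_element \<omega>"
  shows "\<omega> ^ n = 1 \<longleftrightarrow> CARD('a) - 1 dvd n"
proof
  let ?Q = "CARD('a) - 1"
  have one: "\<omega> ^ ?Q = 1"
    using power_card_minus_one primitive_element_nonzero[OF prim] by blast
  then show "?Q dvd n \<Longrightarrow> \<omega> ^ n = 1"
    by (auto elim!: dvdE simp: power_mult)
  assume "\<omega> ^ n = 1"
  define r where "r = n mod ?Q"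
  have "\<omega> ^ n = \<omega> ^ (?Q * (n div ?Q) + r)" by (simp add: r_def)
  then have r: "\<omega> ^ r = 1" using \<open>\<omega> ^ n = 1\<close> unfolding power_add power_mult one by simp
  have Q0: "?Q > 0"
    using card_mono[of "UNIV :: 'a set" "{0, 1}"] by simp
  then have "r < ?Q" by (simp add: r_def)
  have "r = 0"
  proof (rule ccontr)
    assume "r \<noteq> 0"
    have "range (\<lambda>j::nat. \<omega> ^ j) \<subseteq> (\<lambda>j. \<omega> ^ j) ` {..<r}"
    proof (intro image_subsetI)
      fix j :: nat
      have "\<omega> ^ j = \<omega> ^ (r * (j div r) + j mod r)" by simp
      also have "\<dots> = \<omega> ^ (j mod r)" unfolding power_add power_mult r by simp
      finally show "\<omega> ^ j \<in> (\<lambda>j. \<omega> ^ j) ` {..<r}" using \<open>r \<noteq> 0\<close> by auto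
    qed
    then have "card (UNIV - {0::'a}) \<le> card ((\<lambda>j. \<omega> ^ j) ` {..<r})"
      using prim unfolding primitive_element_def by (metis card_mono finite)
    also have "\<dots> \<le> r" using card_image_le[of "{..<r}"] by simp
    finally show False using \<open>r < ?Q\<close> by (simp add: card_Diff_singleton)
  qed
  then show "?Q dvd n" by (simp add: r_def dvd_eq_mod_eq_0)
qed

text \<open>If \<open>\<omega> ^ e\<close> is not 1, substituting \<open>y * \<omega>\<close> for
  \<open>y\<close> scales the sum by \<open>\<omega> ^ e\<close>, so it vanishes. For
  \<open>e = 0\<close> the convention \<open>0 ^ 0 = 1\<close> makes the sum
  \<open>CARD('a)\<close>, which is 0 in the field.\<close>

lemma sum_powers_finite_field:
  fixes \<omega> :: "'a::{field,finite}"
  assumes prim: "primitive_element \<omega>"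
  shows "(\<Sum>y\<in>UNIV. y ^ e :: 'a) = (if e > 0 \<and> CARD('a) - 1 dvd e then - 1 else 0)"
proof -
  have card0: "(of_nat CARD('a) :: 'a) = 0"
    by (simp add: of_nat_eq_0_iff_char_dvd CHAR_dvd_CARD)
  consider "e = 0" | "e > 0" "CARD('a) - 1 dvd e" | "\<not> CARD('a) - 1 dvd e" by auto
  then show ?thesis
  proof cases
    case 1
    then show ?thesis using card0 by simp
  next
    case 2
    have "y ^ e = 1" if "y \<noteq> 0" for y :: 'a
      using 2(2) power_card_minus_one[OF that] by (auto elim!: dvdE simp: power_mult)
    then have "(\<Sum>y\<in>UNIV - {0}. y ^ e :: 'a) = of_nat (CARD('a) - 1)"
      by (simp add: card_Diff_singleton)
    moreover have "(\<Sum>y\<in>UNIV. y ^ e :: 'a) = 0 ^ e + (\<Sum>y\<in>UNIV - {0}. y ^ e)"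
      by (rule sum.remove) auto
    ultimately show ?thesis using 2 card0 by (simp add: of_nat_diff)
  next
    case 3
    then have "\<omega> ^ e \<noteq> 1" using primitive_power_eq_1_iff[OF prim] by simp
    have "(\<Sum>y\<in>UNIV. y ^ e :: 'a) = (\<Sum>y\<in>UNIV. (y * \<omega>) ^ e)"
      using sum.reindex_bij_betw[OF bij_mult_map[OF primitive_element_nonzero[OF prim]], of "\<lambda>y. y ^ e"]
      by (simp add: mult_map_def)
    also have "\<dots> = (\<Sum>y\<in>UNIV. y ^ e) * \<omega> ^ e"
      by (simp add: power_mult_distrib sum_distrib_right)
    finally show ?thesis using 3 \<open>\<omega> ^ e \<noteq> 1\<close> by simp
  qed
qed

text \<open>Expanding \<open>(w - y) ^ b\<close> leaves the power sums with exponents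
  \<open>a + m\<close>, which survive only at positive multiples of \<open>Q\<close>. The strict
  bound \<open>b < Q\<close> keeps \<open>a + m\<close> below \<open>2 * Q\<close>, so only
  \<open>m = Q - a\<close> remains.\<close>

lemma convolution_powers:
  fixes \<omega> w :: "'a::{field,finite}"
  assumes prim: "primitive_element \<omega>" and Q: "Q = CARD('a) - 1" and ab: "a \<le> Q" "b < Q"
  shows "(\<Sum>y\<in>UNIV. y ^ a * (w - y) ^ b) =
    (if Q \<le> a + b then - ((- 1) ^ (Q - a) * of_nat (b choose (Q - a)) * w ^ (a + b - Q)) else 0)"
proof -
  have "(w - y) ^ b = (\<Sum>m\<le>b. (- 1) ^ m * of_nat (b choose m) * w ^ (b - m) * y ^ m)" for y
    using binomial_ring[of "- y" w b] by (simp add: power_minus[of y] mult_ac)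
  then have "(\<Sum>y\<in>UNIV. y ^ a * (w - y) ^ b) =
      (\<Sum>y\<in>UNIV. \<Sum>m\<le>b. (- 1) ^ m * of_nat (b choose m) * w ^ (b - m) * y ^ (a + m))"
    by (simp add: sum_distrib_left power_add mult_ac)
  also have "\<dots> = (\<Sum>m\<le>b. (- 1) ^ m * of_nat (b choose m) * w ^ (b - m) * (\<Sum>y\<in>UNIV. y ^ (a + m)))"
    by (subst sum.swap) (simp add: sum_distrib_left)
  also have "\<dots> = (\<Sum>m\<le>b. if m = Q - a
      then - ((- 1) ^ (Q - a) * of_nat (b choose (Q - a)) * w ^ (b - (Q - a))) else 0)"
  proof (rule sum.cong)
    fix m assume "m \<in> {..b}"
    then have "a + m < 2 * Q" using ab by simp
    then have "a + m = Q" if "a + m > 0" "Q dvd a + m"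
      using that by (auto elim!: dvdE simp: less_2_cases_iff)
    then have "a + m > 0 \<and> Q dvd a + m \<longleftrightarrow> m = Q - a"
      using ab by auto
    then show "(- 1) ^ m * of_nat (b choose m) * w ^ (b - m) * (\<Sum>y\<in>UNIV. y ^ (a + m)) =
        (if m = Q - a then - ((- 1) ^ (Q - a) * of_nat (b choose (Q - a)) * w ^ (b - (Q - a))) else 0)"
      using sum_powers_finite_field[OF prim, of "a + m"] Q by auto
  qed simp
  finally show ?thesis using ab by (auto simp: algebra_simps)
qed

definition invariant_kernel :: "('a::ab_group_add \<Rightarrow> 'a) \<Rightarrow> ('a \<Rightarrow> 'b) \<Rightarrow> bool" where
  "invariant_kernel f g \<longleftrightarrow> (\<forall>x y. g (f x - f y) = g (x - y))"

text \<open>Convolution is the product of the matrices with entries \<open>g (x - y)\<close> and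
  \<open>h (x - y)\<close>. Both are unchanged when \<open>f\<close> permutes rows and columns
  simultaneously, hence so is their product.\<close>

lemma invariant_kernel_convolution:
  fixes g h :: "'a::{field,finite} \<Rightarrow> 'a"
  assumes f: "bij f" and g: "invariant_kernel f g" and h: "invariant_kernel f h"
  shows "invariant_kernel f (\<lambda>w. \<Sum>y\<in>UNIV. g y * h (w - y))"
  unfolding invariant_kernel_def
proof (intro allI)
  fix x z
  have bij: "bij (\<lambda>u. c - u)" for c :: 'a
    by (rule bij_betw_byWitness[where f' = "\<lambda>u. c - u"]) auto
  have "(\<Sum>y\<in>UNIV. g y * h (f x - f z - y)) = (\<Sum>u\<in>UNIV. g (f x - f u) * h (f u - f z))"
    using sum.reindex_bij_betw[OF bij_comp[OF f bij[of "f x"]], of "\<lambda>y. g y * h (f x - f z - y)"]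
    by (simp add: algebra_simps)
  also have "\<dots> = (\<Sum>u\<in>UNIV. g (x - u) * h (u - z))"
    using g h by (simp add: invariant_kernel_def)
  also have "\<dots> = (\<Sum>y\<in>UNIV. g y * h (x - z - y))"
    using sum.reindex_bij_betw[OF bij[of x], of "\<lambda>y. g y * h (x - z - y)"]
    by (simp add: algebra_simps)
  finally show "(\<Sum>y\<in>UNIV. g y * h (f x - f z - y)) = (\<Sum>y\<in>UNIV. g y * h (x - z - y))" .
qed

subsection \<open>The power kernel is invariant\<close>

locale gpaley_field =
  fixes p R k :: nat and \<omega> :: "'a::{field,finite}" and Q d N :: nat
  assumes prime_p: "prime p" and R1: "R \<ge> 1" and card_p: "CARD('a) = p ^ R"
    and k2: "k \<ge> 2" and k_dvd: "k dvd p - 1" and prim: "primitive_element \<omega>"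
    and Q_eq: "Q = p ^ R - 1" and d_eq: "d = (p - 1) div k" and N_eq: "N = Q div k"
begin

lemma char_p: "CHAR('a) = p"
  by (rule frobenius_finite_field(1)[OF prime_p card_p])

lemma Q_card: "Q = CARD('a) - 1"
  by (simp add: Q_eq card_p)

lemma p_minus_1: "p - 1 = k * d"
  using k_dvd by (simp add: d_eq)

lemma p_ge: "p \<ge> 3"
  using prime_ge_2_nat[OF prime_p] k_dvd k2 by (cases "p = 2") auto

lemma d_pos: "d \<ge> 1"
  using p_minus_1 p_ge by (cases d) auto

lemma Q_geom: "Q = (p - 1) * (\<Sum>l<R. p ^ l)"
proof -
  have "p ^ n = 1 + (p - 1) * (\<Sum>l<n. p ^ l)" for n
  proof (induction n)
    case (Suc n)
    have "p ^ Suc n = p ^ n + (p - 1) * p ^ n"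
      using p_ge by (simp add: algebra_simps)
    with Suc.IH show ?case by (simp add: algebra_simps)
  qed simp
  then show ?thesis unfolding Q_eq by (metis diff_add_inverse)
qed

lemma N_geom: "N = d * (\<Sum>l<R. p ^ l)"
  using k2 unfolding N_eq Q_geom p_minus_1 by (simp add: mult.assoc)

lemma N_digits: "N = (\<Sum>l<R. d * p ^ l)"
  by (simp add: N_geom sum_distrib_left)

lemma Q_N: "Q = k * N"
  unfolding Q_geom N_geom p_minus_1 by (rule mult.assoc)

lemma geom_ge: "p ^ (R - 1) \<le> (\<Sum>l<R. p ^ l)"
  using R1 by (intro member_le_sum) auto

text \<open>For connectedness: together with 0, the connection set is too large for a proper
  additive subgroup.\<close>

lemma N_ge: "p ^ (R - 1) \<le> N"
  using geom_ge d_pos mult_le_mono[of 1 d] by (fastforce simp: N_geom)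

lemma N_pos: "N > 0"
  using N_ge p_ge by (metis gr0I le_zero_eq not_numeral_le_zero power_eq_0_iff)

lemma two_N_le: "2 * N \<le> Q"
  using k2 by (simp add: Q_N)

lemma N_less: "N < Q"
  using two_N_le N_pos by simp

lemma power_Q: "x \<noteq> 0 \<Longrightarrow> x ^ Q = (1::'a)"
  using power_card_minus_one Q_card by metis

text \<open>Positive exponents are demanded so that \<open>x = 0\<close> is covered as well.\<close>

lemma power_cong_exp:
  fixes x :: 'a
  assumes "s > 0" "t > 0" "[s = t] (mod Q)"
  shows "x ^ s = x ^ t"
proof (cases "x = 0")
  case False
  have "x ^ n = x ^ (n mod Q)" for n
  proof -
    have "x ^ n = x ^ (Q * (n div Q) + n mod Q)" by simp
    then show ?thesis unfolding power_add power_mult power_Q[OF False] by simp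
  qed
  then show ?thesis using assms(3) by (metis cong_def)
qed (use assms in \<open>simp add: power_0_left\<close>)

lemma poly_eq_of_agree:
  fixes P P' :: "'a poly"
  assumes "degree P \<le> Q" "degree P' \<le> Q" "\<And>x. poly P x = poly P' x"
  shows "P = P'"
proof (rule poly_eqI_degree[where A = UNIV])
  have "Q < CARD('a)" unfolding Q_card by (simp add: card_gt_0_iff)
  with assms(1,2) show "degree P < card (UNIV :: 'a set)" "degree P' < card (UNIV :: 'a set)"
    by linarith+
qed (use assms in auto)

lemma S_eq: "{\<omega> ^ (j * k) | j::nat. True} = {x. x ^ N = 1}"
proof (intro equalityI subsetI)
  fix x assume "x \<in> {\<omega> ^ (j * k) | j::nat. True}"
  then obtain j where "x = \<omega> ^ (j * k)" by auto
  then have "x ^ N = \<omega> ^ (Q * j)" by (simp add: Q_N power_mult[symmetric] mult_ac)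
  then show "x \<in> {x. x ^ N = 1}"
    using primitive_power_eq_1_iff[OF prim] Q_card by simp
next
  fix x :: 'a assume "x \<in> {x. x ^ N = 1}"
  then have x: "x ^ N = 1" by simp
  then have "x \<noteq> 0" using N_pos by (auto simp: power_0_left)
  then obtain i where i: "x = \<omega> ^ i" using prim by (auto simp: primitive_element_def)
  then have "Q dvd i * N"
    using x primitive_power_eq_1_iff[OF prim, of "i * N"] Q_card by (simp add: power_mult)
  then have "k dvd i" using N_pos by (simp add: Q_N)
  then show "x \<in> {\<omega> ^ (j * k) | j::nat. True}" using i by (auto elim!: dvdE simp: mult.commute)
qed

text \<open>As a function of \<open>x\<^sup>N\<close>, the kernel \<open>\<Sum>x\<^sup>j\<^sup>N\<close> over \<open>1 \<le> j < k\<close> has degree \<open>k - 1\<close>, and convolving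
  with it lowers the degree by exactly one, the new leading coefficient being a binomial coefficient
  that does not vanish modulo \<open>p\<close>.\<close>

lemma invariant_kernel_power:
  fixes f :: "'a \<Rightarrow> 'a"
  assumes f: "bij f" and S: "\<And>u v. (f u - f v) ^ N = 1 \<longleftrightarrow> (u - v) ^ N = 1"
  shows "invariant_kernel f (\<lambda>x. x ^ N)"
proof -
  define g where "g x = (\<Sum>i\<in>{1..<k}. x ^ (i * N))" for x :: 'a
  \<comment> \<open>For nonzero \<open>x\<close>, \<open>1 + g x\<close> is a geometric sum of
    \<open>k\<close>-th roots of unity: \<open>k\<close> on the connection set and 0 off it. So
    \<open>g\<close> is constant on three classes of differences, each respected by
    \<open>f\<close>.\<close>
  have g_val: "g x = (if x = 0 then 0 else if x ^ N = 1 then of_nat (k - 1) else - 1)" for x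
  proof -
    have g': "g x = (\<Sum>i\<in>{1..<k}. (x ^ N) ^ i)"
      unfolding g_def by (simp add: power_mult[symmetric] mult.commute)
    consider "x = 0" | "x \<noteq> 0" "x ^ N = 1" | "x \<noteq> 0" "x ^ N \<noteq> 1" by blast
    then show ?thesis
    proof cases
      case 1
      then show ?thesis using N_pos unfolding g_def by (simp add: power_0_left)
    next
      case 2
      then show ?thesis by (simp add: g')
    next
      case 3
      have "(\<Sum>i<k. (x ^ N) ^ i) = 0"
        using geometric_sum[OF 3(2), of k] power_Q[OF 3(1)]
        by (simp add: Q_N power_mult[symmetric] mult.commute)
      moreover have "(\<Sum>i<k. (x ^ N) ^ i) = 1 + g x"
        using k2 unfolding g' lessThan_atLeast0 by (subst sum.atLeast_Suc_lessThan) auto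
      ultimately show ?thesis using 3 by (simp add: eq_neg_iff_add_eq_0 add.commute)
    qed
  qed
  have "f x - f y = 0 \<longleftrightarrow> x - y = 0" for x y
    using f by (simp add: bij_def inj_eq)
  then have g: "invariant_kernel f g"
    unfolding invariant_kernel_def g_val using S by simp
  \<comment> \<open>Repeated convolution with \<open>g\<close> lowers the degree from
    \<open>k - 1\<close> at \<open>t = 1\<close> to 1 at \<open>t = k - 1\<close>.\<close>
  have "\<exists>P. degree P = k - t \<and> invariant_kernel f (\<lambda>x. poly P (x ^ N))" if "1 \<le> t" "t \<le> k - 1" for t
    using that
  proof (induction t rule: dec_induct)
    case base
    define P where "P = (\<Sum>i\<in>{1..<k}. monom (1::'a) i)"
    have "coeff P (k - 1) = (\<Sum>i\<in>{1..<k}. if i = k - 1 then 1 else 0)"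
      unfolding P_def by (simp add: coeff_sum)
    also have "\<dots> = 1" using k2 by (subst sum.delta) auto
    finally have "degree P \<ge> k - 1" by (intro le_degree) simp
    moreover have "degree P \<le> k - 1"
      unfolding P_def by (intro degree_sum_le) (auto simp: degree_monom_eq)
    moreover have "poly P (x ^ N) = g x" for x
      by (simp add: P_def g_def poly_sum poly_monom power_mult[symmetric] mult.commute)
    ultimately show ?case using g by (intro exI[of _ P]) auto
  next
    case (step t)
    then obtain P where P: "degree P = k - t" "invariant_kernel f (\<lambda>x. poly P (x ^ N))" by auto
    define c where "c j i = - ((- 1) ^ (Q - j * N) * of_nat (i * N choose (Q - j * N)) :: 'a)" for i j
    define M where "M j i = (if k \<le> j + i then monom (coeff P j * c j i) (j + i - k) else 0)" for i j
    define P' where "P' = (\<Sum>j\<le>k - t. \<Sum>i\<in>{1..<k}. M j i)"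
    have conv: "poly P' (w ^ N) = (\<Sum>y\<in>UNIV. poly P (y ^ N) * g (w - y))" for w
    proof -
      have M: "coeff P j * (\<Sum>y\<in>UNIV. y ^ (j * N) * (w - y) ^ (i * N)) = poly (M j i) (w ^ N)"
        if "j \<le> k - t" "i \<in> {1..<k}" for i j
      proof -
        have "j * N \<le> Q" "i * N < Q" using that N_pos by (auto simp: Q_N)
        moreover have "Q \<le> j * N + i * N \<longleftrightarrow> k \<le> j + i"
          using N_pos by (simp add: Q_N add_mult_distrib[symmetric])
        moreover have "j * N + i * N - Q = N * (j + i - k)"
          by (simp add: Q_N algebra_simps)
        ultimately show ?thesis
          using convolution_powers[OF prim Q_card, of "j * N" "i * N" w]
          by (simp add: M_def c_def poly_monom power_mult)
      qed
      have "(\<Sum>y\<in>UNIV. poly P (y ^ N) * g (w - y)) =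
          (\<Sum>y\<in>UNIV. \<Sum>j\<le>k - t. \<Sum>i\<in>{1..<k}. coeff P j * (y ^ (j * N) * (w - y) ^ (i * N)))"
        unfolding poly_altdef g_def P(1) sum_product
        by (simp add: power_mult[symmetric] mult.assoc mult.commute[of N])
      also have "\<dots> = (\<Sum>j\<le>k - t. \<Sum>i\<in>{1..<k}. coeff P j * (\<Sum>y\<in>UNIV. y ^ (j * N) * (w - y) ^ (i * N)))"
        by (subst sum.swap, rule sum.cong, simp, subst sum.swap) (simp add: sum_distrib_left)
      also have "\<dots> = poly P' (w ^ N)"
        unfolding P'_def poly_sum by (intro sum.cong refl M) auto
      finally show ?thesis ..
    qed
    have inv: "invariant_kernel f (\<lambda>x. poly P' (x ^ N))"
      using invariant_kernel_convolution[OF f P(2) g] unfolding conv .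
    have "degree (M j i) \<le> k - Suc t" if "j \<le> k - t" "i \<in> {1..<k}" for i j
    proof (cases "k \<le> j + i")
      case True
      have "degree (M j i) \<le> j + i - k" unfolding M_def using True by (simp add: degree_monom_le)
      with that step.prems show ?thesis by auto
    qed (simp add: M_def)
    then have deg: "degree P' \<le> k - Suc t"
      unfolding P'_def by (intro degree_sum_le) auto
    have top: "coeff (M j i) (k - Suc t) = (if j = k - t then if i = k - 1 then coeff P j * c j i else 0 else 0)"
      if "j \<le> k - t" "i \<in> {1..<k}" for i j
    proof -
      \<comment> \<open>Only the product of the two leading terms reaches the top degree, so nothing
        can cancel it.\<close>
      have "k \<le> j + i \<and> j + i - k = k - Suc t \<longleftrightarrow> j = k - t \<and> i = k - 1"
        using that step.hyps step.prems by auto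
      moreover have "coeff (M j i) (k - Suc t) =
          (if k \<le> j + i \<and> j + i - k = k - Suc t then coeff P j * c j i else 0)"
        unfolding M_def
        by (cases "k \<le> j + i") (simp_all only: coeff_monom coeff_0 if_True if_False simp_thms)
      ultimately show ?thesis
        by (cases "j = k - t"; cases "i = k - 1") (simp_all only: if_True if_False simp_thms)
    qed
    have "coeff P' (k - Suc t) =
        (\<Sum>j\<le>k - t. \<Sum>i\<in>{1..<k}. if j = k - t then if i = k - 1 then coeff P j * c j i else 0 else 0)"
      unfolding P'_def coeff_sum by (intro sum.cong refl top) auto
    also have "\<dots> = (\<Sum>j\<le>k - t. if j = k - t then coeff P j * c j (k - 1) else 0)"
      using k2 by (intro sum.cong refl) (auto simp: sum.delta)
    also have "\<dots> = coeff P (k - t) * c (k - t) (k - 1)"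
      by (subst sum.delta) auto
    finally have lead: "coeff P' (k - Suc t) = coeff P (k - t) * c (k - t) (k - 1)" .
    \<comment> \<open>No carries occur: the digits of \<open>(k - 1) * N\<close> and
      \<open>t * N\<close> are constantly \<open>(k - 1) * d\<close> and \<open>t * d\<close>, so
      the binomial coefficient in the new leading term is nonzero.\<close>
    have "(k - 1) * d < p"
    proof -
      have "(k - 1) * d \<le> k * d" by simp
      then show ?thesis using p_minus_1 p_ge by linarith
    qed
    then have "(of_nat ((\<Sum>l<R. ((k - 1) * d) * p ^ l) choose (\<Sum>l<R. (t * d) * p ^ l)) :: 'a) \<noteq> 0"
      using step.prems by (intro binomial_digits_nonzero prime_p char_p) auto
    moreover have "(\<Sum>l<R. (m * d) * p ^ l) = m * N" for m
      by (simp add: N_digits sum_distrib_left mult_ac)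
    moreover have "Q - (k - t) * N = t * N"
    proof -
      have "Q = (k - t) * N + t * N"
        using step.prems by (simp add: Q_N add_mult_distrib[symmetric])
      then show ?thesis by simp
    qed
    ultimately have "c (k - t) (k - 1) \<noteq> 0" by (simp add: c_def)
    moreover have "P \<noteq> 0" using P(1) step.prems by auto
    ultimately have "coeff P' (k - Suc t) \<noteq> 0"
      using lead P(1) by (metis leading_coeff_0_iff mult_eq_0_iff)
    then have "degree P' = k - Suc t" using deg le_degree by (metis le_antisym)
    with inv show ?case by blast
  qed
  moreover have "1 \<le> k - 1" "k - (k - 1) = 1" using k2 by auto
  ultimately obtain P where P: "degree P = 1" "invariant_kernel f (\<lambda>x. poly P (x ^ N))"
    by (metis order_refl)
  \<comment> \<open>An affine function of \<open>x ^ N\<close> with nonzero slope is invariant;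
    constant and slope cancel.\<close>
  have "P = [:coeff P 0, coeff P 1:]"
    using P(1) by (intro poly_eqI) (auto simp: coeff_pCons coeff_eq_0 split: nat.split)
  then have "poly P z = coeff P 0 + coeff P 1 * z" for z
    by (metis add.right_neutral mult.commute mult_zero_right poly_0 poly_pCons)
  moreover have "coeff P 1 \<noteq> 0" using P(1) by (metis leading_coeff_0_iff one_neq_zero degree_0)
  ultimately show ?thesis using P(2) by (simp add: invariant_kernel_def)
qed

subsection \<open>Bijections preserving the power kernel\<close>

lemma digits_binomial_nonzero:
  assumes "\<And>l. l < R \<Longrightarrow> a l \<le> d"
  shows "(of_nat (N choose (\<Sum>l<R. a l * p ^ l)) :: 'a) \<noteq> 0"
proof -
  have "d \<le> k * d" using k2 by simp
  then have "d < p" using p_minus_1 p_ge by linarith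
  then show ?thesis unfolding N_digits
    using assms by (intro binomial_digits_nonzero prime_p char_p) auto
qed

context
  fixes f :: "'a \<Rightarrow> 'a"
  assumes f: "bij f" and f0: "f 0 = 0" and f_N: "invariant_kernel f (\<lambda>x. x ^ N)"
begin

lemma power_is_low_degree_poly:
  assumes m: "(of_nat (N choose m) :: 'a) \<noteq> 0"
  obtains P where "degree P \<le> N" "\<And>x. poly P x = f x ^ m"
proof -
  have mN: "m \<le> N" using m by (metis binomial_eq_0 not_less of_nat_0)
  \<comment> \<open>The degree bound is visible in this form. By invariance \<open>x - y\<close> may
    be replaced by \<open>f x - f y\<close>, and the exponent \<open>Q - (N - m)\<close> is chosen
    so that the convolution retains exactly \<open>f x ^ m\<close>.\<close>
  define P where "P = (\<Sum>y\<in>UNIV. smult (f y ^ (Q - (N - m))) ([:- y, 1:] ^ N))"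
  define c where "c = - ((- 1) ^ (N - m) * of_nat (N choose m) :: 'a)"
  have "c \<noteq> 0" using m by (simp add: c_def)
  have "degree P \<le> N"
    unfolding P_def
    by (intro degree_sum_le) (auto intro!: order.trans[OF degree_smult_le] simp: degree_linear_power)
  moreover have "poly P x = c * f x ^ m" for x
  proof -
    have "poly P x = (\<Sum>y\<in>UNIV. f y ^ (Q - (N - m)) * (x - y) ^ N)"
      by (simp add: P_def poly_sum)
    also have "\<dots> = (\<Sum>y\<in>UNIV. f y ^ (Q - (N - m)) * (f x - f y) ^ N)"
      using f_N by (simp add: invariant_kernel_def)
    also have "\<dots> = (\<Sum>z\<in>UNIV. z ^ (Q - (N - m)) * (f x - z) ^ N)"
      using sum.reindex_bij_betw[OF f, of "\<lambda>z. z ^ (Q - (N - m)) * (f x - z) ^ N"] by simp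
    also have "\<dots> = c * f x ^ m"
    proof -
      have "Q - (Q - (N - m)) = N - m" "Q - (N - m) + N - Q = m" "Q \<le> Q - (N - m) + N"
        using N_less mN by auto
      then show ?thesis
        using convolution_powers[OF prim Q_card _ N_less, of "Q - (N - m)" "f x"]
          binomial_symmetric[OF mN] by (simp add: c_def)
    qed
    finally show ?thesis .
  qed
  ultimately show ?thesis
    using \<open>c \<noteq> 0\<close> by (intro that[of "smult (inverse c) P"]) auto
qed

lemma monomial_form:
  obtains c e where "c \<noteq> 0" "0 < e" "e \<le> N" "\<And>x. f x = c * x ^ e"
proof -
  \<comment> \<open>The number 1 has lowest digit 1 and all others 0, each at most
    \<open>d\<close>.\<close>
  have N1: "(of_nat (N choose 1) :: 'a) \<noteq> 0"
    using digits_binomial_nonzero[of "\<lambda>l. if l = 0 then 1 else 0"] d_pos R1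
    by (simp add: if_distrib[of "\<lambda>x. x * _"] cong: if_cong)
  then have N2: "(of_nat (N choose (N - 1)) :: 'a) \<noteq> 0"
    using binomial_symmetric[of 1 N] N_pos by simp
  obtain P where P: "degree P \<le> N" "\<And>x. poly P x = f x ^ 1"
    using power_is_low_degree_poly[OF N1] by blast
  obtain P' where P': "degree P' \<le> N" "\<And>x. poly P' x = f x ^ (N - 1)"
    using power_is_low_degree_poly[OF N2] by blast
  have "P * P' = monom 1 N"
  proof (rule poly_eq_of_agree)
    show "degree (P * P') \<le> Q"
      using degree_mult_le[of P P'] P(1) P'(1) two_N_le by linarith
    show "degree (monom 1 N :: 'a poly) \<le> Q"
      using N_less by (simp add: degree_monom_eq)
    fix x
    have "poly (P * P') x = f x ^ N"
      using N_pos by (simp add: P P' power_eq_if)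
    also have "\<dots> = x ^ N"
      using f_N f0 unfolding invariant_kernel_def by (metis diff_zero)
    finally show "poly (P * P') x = poly (monom 1 N) x" by (simp add: poly_monom)
  qed
  then obtain c e where ce: "P = monom c e" "c \<noteq> 0" by (rule poly_mult_eq_monomD)
  have fx: "f x = c * x ^ e" for x using P(2)[of x] by (simp add: ce poly_monom)
  moreover have "e \<le> N" using P(1) ce by (simp add: degree_monom_eq)
  moreover have "0 < e" using fx[of 0] f0 ce(2) by (cases e) auto
  ultimately show ?thesis using that ce(2) by blast
qed

lemma semilinear_form:
  obtains c j where "c ^ N = 1" "\<And>x. f x = c * x ^ (p ^ j)"
proof -
  obtain c e where c: "c \<noteq> 0" and e: "0 < e" "e \<le> N" and fx: "\<And>x. f x = c * x ^ e"
    using monomial_form by blast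
  define E where "E l = e * p ^ l mod Q" for l
  have E_pos: "E l > 0" if "l < R" for l
  proof (rule ccontr)
    assume "\<not> E l > 0"
    then have "Q dvd e * p ^ l * p ^ (R - l)" by (simp add: E_def dvd_eq_mod_eq_0[symmetric])
    also have "e * p ^ l * p ^ (R - l) = e * p ^ R"
      using that by (simp add: mult.assoc power_add[symmetric])
    also have "p ^ R = Q + 1" using N_less Q_eq by simp
    finally have "Q dvd e" by (simp add: dvd_add_right_iff)
    then show False using e N_less by (auto dest: dvd_imp_le)
  qed
  define m where "m a = (\<Sum>l<R. a l * p ^ l)" for a :: "nat \<Rightarrow> nat"
  define s where "s a = (\<Sum>l<R. a l * E l)" for a :: "nat \<Rightarrow> nat"
  \<comment> \<open>As functions, \<open>f ^ m a\<close> and \<open>c ^ m a * x ^ s a\<close> agree,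
    because \<open>s a\<close> is congruent to \<open>e * m a\<close> modulo \<open>Q\<close>. Once
    \<open>s a \<le> Q\<close>, they agree as polynomials too, and the degree bound for
    \<open>f ^ m a\<close> applies to \<open>s a\<close>.\<close>
  have bound: "s a \<le> N" if a: "\<And>l. l < R \<Longrightarrow> a l \<le> d" and le: "s a \<le> Q" for a
  proof (cases "s a = 0")
    case False
    have cong: "[s a = e * m a] (mod Q)"
    proof -
      have "[s a = (\<Sum>l<R. a l * (e * p ^ l))] (mod Q)"
        unfolding s_def E_def by (intro cong_sum cong_mult) (auto simp: cong_def)
      then show ?thesis by (simp add: m_def sum_distrib_left mult_ac)
    qed
    have "m a > 0"
      using False e(1) p_ge unfolding m_def s_def by (intro gr0I) auto
    have "(of_nat (N choose m a) :: 'a) \<noteq> 0"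
      unfolding m_def by (rule digits_binomial_nonzero[OF a])
    then obtain P where P: "degree P \<le> N" "\<And>x. poly P x = f x ^ m a"
      using power_is_low_degree_poly by blast
    have "P = monom (c ^ m a) (s a)"
    proof (rule poly_eq_of_agree)
      show "degree P \<le> Q" using P(1) N_less by simp
      show "degree (monom (c ^ m a) (s a)) \<le> Q" using c le by (simp add: degree_monom_eq)
      fix x
      have "poly P x = c ^ m a * x ^ (e * m a)"
        by (simp add: P(2) fx power_mult_distrib power_mult)
      also have "x ^ (e * m a) = x ^ s a"
        using False e(1) \<open>m a > 0\<close> cong by (intro power_cong_exp) (auto simp: cong_sym)
      finally show "poly P x = poly (monom (c ^ m a) (s a)) x" by (simp add: poly_monom)
    qed
    then show ?thesis using P(1) c by (simp add: degree_monom_eq)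
  qed simp
  have E_le: "E l \<le> N" if "l < R" for l
  proof -
    have "s (\<lambda>i. if i = l then 1 else 0) = E l"
      using that by (simp add: s_def if_distrib[of "\<lambda>x. x * _"] cong: if_cong)
    moreover have "E l \<le> Q" using N_less by (simp add: E_def)
    ultimately show ?thesis using bound[of "\<lambda>i. if i = l then 1 else 0"] d_pos by simp
  qed
  \<comment> \<open>The proviso \<open>s a \<le> Q\<close> of \<open>bound\<close> is met by raising
    the digits one unit at a time: each unit adds some \<open>E l \<le> N\<close> to a value at most
    \<open>N\<close>, giving at most \<open>2 * N \<le> Q\<close>, and \<open>bound\<close> brings
    this back to at most \<open>N\<close>.\<close>
  have s_le: "s a \<le> N" if "\<And>l. l < R \<Longrightarrow> a l \<le> d" "(\<Sum>l<R. a l) = n" for a n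
    using that
  proof (induction n arbitrary: a)
    case 0
    then show ?case by (simp add: s_def)
  next
    case (Suc n)
    then obtain l where l: "l < R" "a l > 0"
      by (metis gr0I lessThan_iff nat.distinct(1) sum.neutral)
    define b where "b = a(l := a l - 1)"
    have split: "(\<Sum>i<R. a i * g i) = (\<Sum>i<R. b i * g i) + g l" for g :: "nat \<Rightarrow> nat"
    proof -
      have "(\<Sum>i<R. a i * g i) = a l * g l + (\<Sum>i\<in>{..<R} - {l}. a i * g i)"
        using l by (intro sum.remove) auto
      moreover have "(\<Sum>i<R. b i * g i) = b l * g l + (\<Sum>i\<in>{..<R} - {l}. b i * g i)"
        using l by (intro sum.remove) auto
      moreover have "(\<Sum>i\<in>{..<R} - {l}. a i * g i) = (\<Sum>i\<in>{..<R} - {l}. b i * g i)"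
        by (intro sum.cong) (auto simp: b_def)
      moreover have "a l * g l = b l * g l + g l"
        using l by (cases "a l") (auto simp: b_def)
      ultimately show ?thesis by simp
    qed
    have "(\<Sum>i<R. b i) = n" using split[of "\<lambda>_. 1"] Suc.prems(2) by simp
    moreover have "b i \<le> d" if "i < R" for i
      using Suc.prems(1)[OF that] by (auto simp: b_def)
    ultimately have "s b \<le> N" by (intro Suc.IH)
    moreover have "s a = s b + E l" unfolding s_def by (rule split)
    ultimately have "s a \<le> Q" using E_le[OF l(1)] two_N_le by linarith
    then show ?case using Suc.prems(1) by (intro bound)
  qed
  \<comment> \<open>All digits equal to \<open>d\<close>, the largest choice allowed, gives the
    bound on the sum of the cyclic shifts.\<close>
  have "d * (\<Sum>l<R. E l) \<le> d * (\<Sum>l<R. p ^ l)"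
    using s_le[of "\<lambda>_. d"] by (simp add: s_def sum_distrib_left[symmetric] N_geom)
  then have "(\<Sum>l<R. E l) \<le> (\<Sum>l<R. p ^ l)" using d_pos by simp
  then have "(p - 1) * (\<Sum>l<R. e * p ^ l mod (p ^ R - 1)) \<le> p ^ R - 1"
    using Q_geom unfolding E_def Q_eq by (metis mult_le_mono2)
  moreover have "e < p ^ R - 1" using e N_less Q_eq by simp
  ultimately obtain j where "e = p ^ j"
    using cyclic_shift_sum_le_imp_power[of e p R] e(1) by auto
  moreover have "c ^ N = 1"
    using f_N f0 fx[of 1] unfolding invariant_kernel_def by (metis diff_zero mult.right_neutral power_one)
  ultimately show ?thesis using fx that by blast
qed

end

subsection \<open>The automorphism group\<close>

lemma mem_GPaley_arcs: "(u, v) \<in> parcs (GPaley \<omega> k) \<longleftrightarrow> (v - u) ^ N = 1"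
  using S_eq by (auto simp: GPaley_def cayley_graph_def)

lemma graph_Aut_iff:
  "f \<in> graph_Aut (GPaley \<omega> k) \<longleftrightarrow> bij f \<and> (\<forall>u v. (f u - f v) ^ N = 1 \<longleftrightarrow> (u - v) ^ N = 1)"
  unfolding graph_Aut_def mem_GPaley_arcs
  by (auto simp: GPaley_def cayley_graph_def Bij_def)

abbreviation "Sym \<equiv> BijGroup (UNIV :: 'a set)"
abbreviation "Lin \<equiv> generate Sym {mult_map (\<omega> ^ k), frobenius p}"

lemma Lin_generators_bij_additive: "f \<in> {mult_map (\<omega> ^ k), frobenius p} \<Longrightarrow> bij f"
  "f \<in> {mult_map (\<omega> ^ k), frobenius p} \<Longrightarrow> f (x + y) = f x + f y"
  using bij_mult_map[of "\<omega> ^ k"] primitive_element_nonzero[OF prim]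
    frobenius_finite_field(2,3)[OF prime_p card_p]
  by (auto simp: mult_map_def distrib_right)

lemma Lin_bij_additive:
  assumes "h \<in> Lin"
  shows "bij h" "h (x + y) = h x + h y"
  using generate_additive[OF Lin_generators_bij_additive assms] by auto

lemma subgroup_Lin: "subgroup Lin Sym"
  using Lin_generators_bij_additive(1)
  by (intro group.generate_is_subgroup[OF group_BijGroup]) (auto simp: BijGroup_UNIV_simps)

lemma Lin_comp: "h \<in> Lin \<Longrightarrow> h' \<in> Lin \<Longrightarrow> h \<circ> h' \<in> Lin"
  using subgroup.m_closed[OF subgroup_Lin, of h h'] Lin_bij_additive(1)
  by (simp add: BijGroup_UNIV_simps)

lemma Lin_generators_preserve:
  assumes "h \<in> {mult_map (\<omega> ^ k), frobenius p}"
  shows "h x ^ N = 1 \<longleftrightarrow> x ^ N = 1"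
proof -
  have "(\<omega> ^ k) ^ N = 1"
    using power_Q[OF primitive_element_nonzero[OF prim]] by (simp add: Q_N power_mult)
  moreover have "(x ^ p) ^ N = 1 \<longleftrightarrow> x ^ N = 1"
    using bij_is_inj[OF frobenius_finite_field(2)[OF prime_p card_p]]
    by (metis frobenius_def injD mult.commute power_mult power_one)
  ultimately show ?thesis
    using assms by (auto simp: mult_map_def frobenius_def power_mult_distrib)
qed

lemma Lin_preserves:
  assumes "h \<in> Lin"
  shows "h x ^ N = 1 \<longleftrightarrow> x ^ N = 1"
  using assms
proof (induction arbitrary: x rule: generate.induct)
  case one
  then show ?case by (simp add: BijGroup_UNIV_simps)
next
  case (incl h)
  then show ?case by (rule Lin_generators_preserve)
next
  case (inv h)
  have "bij h" using inv by (rule Lin_generators_bij_additive(1))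
  then show ?case
    using Lin_generators_preserve[OF inv, of "inv_into UNIV h x"]
    by (simp add: inv_BijGroup_UNIV bij_is_surj surj_f_inv_f)
next
  case (eng f g)
  then show ?case using Lin_bij_additive(1) by (simp add: BijGroup_UNIV_simps)
qed

lemma semilinear_in_Lin:
  assumes "c ^ N = 1"
  shows "(\<lambda>x. c * x ^ (p ^ j)) \<in> Lin"
proof -
  have id: "(\<lambda>x. x) \<in> Lin"
    using subgroup.one_closed[OF subgroup_Lin] by (simp add: BijGroup_UNIV_simps)
  have frob: "(\<lambda>x. x ^ (p ^ j)) \<in> Lin" for j
  proof (induction j)
    case (Suc j)
    have "frobenius p \<in> Lin" by (simp add: generate.incl)
    from Lin_comp[OF this Suc.IH] show ?case
      by (simp add: frobenius_def comp_def power_mult[symmetric] mult.commute)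
  qed (use id in simp)
  have mult: "(\<lambda>x. \<omega> ^ (i * k) * x) \<in> Lin" for i
  proof (induction i)
    case (Suc i)
    have "mult_map (\<omega> ^ k) \<in> Lin" by (simp add: generate.incl)
    from Lin_comp[OF this Suc.IH] show ?case
      by (simp add: mult_map_def comp_def power_add mult_ac)
  qed (use id in simp)
  obtain i where "c = \<omega> ^ (i * k)" using assms S_eq by blast
  then show ?thesis using Lin_comp[OF mult[of i] frob[of j]] by (simp add: comp_def)
qed

text \<open>A translation moves \<open>f 0\<close> to 0, and \<open>semilinear_form\<close> then
  applies. Conversely, elements of \<open>Lin\<close> are additive, so differences pass through
  them, and they preserve the connection set.\<close>

lemma graph_Aut_eq: "graph_Aut (GPaley \<omega> k) = translation_group <#>\<^bsub>Sym\<^esub> Lin"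
proof (intro equalityI subsetI)
  fix f assume "f \<in> graph_Aut (GPaley \<omega> k)"
  then have f: "bij f" "\<And>u v. (f u - f v) ^ N = 1 \<longleftrightarrow> (u - v) ^ N = 1"
    by (auto simp: graph_Aut_iff)
  define h where "h v = f v - f 0" for v
  have "h = (\<lambda>v. v + (- f 0)) \<circ> f" by (simp add: h_def fun_eq_iff)
  then have h: "bij h" using bij_comp[OF f(1) bij_translation] by metis
  moreover have "h 0 = 0" by (simp add: h_def)
  moreover have "invariant_kernel h (\<lambda>x. x ^ N)"
    by (rule invariant_kernel_power[OF h]) (simp add: h_def f(2))
  ultimately obtain c j where c: "c ^ N = 1" and hx: "\<And>x. h x = c * x ^ (p ^ j)"
    using semilinear_form by blast
  have "h = (\<lambda>x. c * x ^ (p ^ j))" using hx by (rule ext)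
  then have "h \<in> Lin" using semilinear_in_Lin[OF c] by simp
  moreover have "f = (\<lambda>v. v + f 0) \<otimes>\<^bsub>Sym\<^esub> h"
    using h by (simp add: BijGroup_UNIV_simps bij_translation fun_eq_iff h_def)
  ultimately show "f \<in> translation_group <#>\<^bsub>Sym\<^esub> Lin"
    unfolding set_mult_def translation_group_def by blast
next
  fix f assume "f \<in> translation_group <#>\<^bsub>Sym\<^esub> Lin"
  then obtain h x where h: "h \<in> Lin" and f: "f = (\<lambda>v. v + x) \<otimes>\<^bsub>Sym\<^esub> h"
    by (auto simp: set_mult_def translation_group_def)
  note bij = Lin_bij_additive(1)[OF h]
  have f': "f = (\<lambda>v. v + x) \<circ> h"
    unfolding f using bij by (simp add: BijGroup_UNIV_simps bij_translation)
  have "f u - f v = h (u - v)" for u v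
    using Lin_bij_additive(2)[OF h, of "u - v" v] by (simp add: f')
  then show "f \<in> graph_Aut (GPaley \<omega> k)"
    unfolding graph_Aut_iff using bij_comp[OF bij bij_translation[of x]] Lin_preserves[OF h]
    by (simp add: f')
qed

lemma Lin_subset: "Lin \<subseteq> generate Sym {mult_map \<omega>, frobenius p}" (is "_ \<subseteq> ?B")
proof -
  have b: "bij f" if "f \<in> {mult_map \<omega>, frobenius p}" for f
    using that bij_mult_map[OF primitive_element_nonzero[OF prim]]
      frobenius_finite_field(2)[OF prime_p card_p] by blast
  then have sub: "subgroup ?B Sym"
    by (intro group.generate_is_subgroup[OF group_BijGroup]) (auto simp: BijGroup_UNIV_simps)
  have "mult_map (\<omega> ^ i) \<in> ?B" for i
  proof (induction i)
    case 0
    show ?case using subgroup.one_closed[OF sub] by (simp add: BijGroup_UNIV_simps mult_map_def)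
  next
    case (Suc i)
    have "mult_map \<omega> \<in> ?B" by (simp add: generate.incl)
    from subgroup.m_closed[OF sub this Suc.IH]
    have "mult_map \<omega> \<circ> mult_map (\<omega> ^ i) \<in> ?B"
      using bij_mult_map[OF primitive_element_nonzero[OF prim]] bij_mult_map[of "\<omega> ^ i"]
        primitive_element_nonzero[OF prim]
      by (simp add: BijGroup_UNIV_simps)
    moreover have "mult_map \<omega> \<circ> mult_map (\<omega> ^ i) = mult_map (\<omega> ^ Suc i)"
      by (simp add: mult_map_def fun_eq_iff mult_ac)
    ultimately show ?case by simp
  qed
  then show ?thesis
    using sub by (intro group.generate_subgroup_incl[OF group_BijGroup]) (auto intro: generate.incl)
qed

subsection \<open>Connectedness\<close>

text \<open>Characteristic \<open>p\<close> gives \<open>- x = (p - 1) * x\<close>, so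
  \<open>V\<close> is a subgroup. By Lagrange its order is a power of \<open>p\<close>, and the only
  one available above \<open>p ^ (R - 1)\<close> is \<open>p ^ R\<close>.\<close>

lemma additive_submonoid_eq_UNIV:
  fixes V :: "'a set"
  assumes zero: "0 \<in> V" and add: "\<And>x y. x \<in> V \<Longrightarrow> y \<in> V \<Longrightarrow> x + y \<in> V"
    and card: "card V > p ^ (R - 1)"
  shows "V = UNIV"
proof -
  let ?A = "\<lparr>carrier = UNIV, monoid.mult = (+), one = 0 :: 'a\<rparr>"
  have A: "group ?A"
    by (rule groupI) (auto simp: add.assoc intro: exI[of _ "- _"])
  then interpret A: group ?A .
  have mult: "of_nat n * x \<in> V" if "x \<in> V" for n x
    by (induction n) (use that zero add in \<open>auto simp: distrib_right\<close>)
  have neg: "- x \<in> V" if "x \<in> V" for x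
  proof -
    have "of_nat (p - 1) * x + x = of_nat p * x"
      using p_ge by (simp add: algebra_simps)
    also have "(of_nat p :: 'a) = 0" using char_p of_nat_CHAR by metis
    finally have "x + of_nat (p - 1) * x = 0" by (simp add: add.commute)
    then have "- x = of_nat (p - 1) * x" by (rule minus_unique)
    then show ?thesis using mult[OF that, of "p - 1"] by (simp only:)
  qed
  have inv: "inv\<^bsub>?A\<^esub> x = - x" for x
    by (rule A.inv_equality) auto
  have "subgroup V ?A"
    by (rule A.subgroupI) (use zero add neg inv in auto)
  from A.lagrange[OF this] have "card (rcosets\<^bsub>?A\<^esub> V) * card V = p ^ R"
    by (simp add: Coset.order_def card_p)
  then have "card V dvd p ^ R" by (metis dvd_triv_right)
  then have "\<exists>i\<le>R. card V = p ^ i" unfolding divides_primepow_nat[OF prime_p] .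
  then obtain i where i: "i \<le> R" "card V = p ^ i" by blast
  then have "\<not> i \<le> R - 1"
    using card p_ge power_increasing[of i "R - 1" p] by fastforce
  then have "i = R" using i(1) by linarith
  then have "card V = CARD('a)" using i(2) card_p by simp
  then show ?thesis by (simp add: card_subset_eq)
qed

lemma connected_GPaley: "Digraph_Component.connected (with_proj (GPaley \<omega> k))"
proof -
  let ?G = "with_proj (mk_symmetric (with_proj (GPaley \<omega> k)))"
  have verts: "verts ?G = UNIV" by (simp add: GPaley_def cayley_graph_def)
  interpret S: wf_digraph ?G
    by unfold_locales (simp_all add: GPaley_def cayley_graph_def)
  \<comment> \<open>Asking for reachability of \<open>u + x\<close> from every \<open>u\<close>
    makes the set of displacements closed under addition.\<close>
  define V where "V = {x. \<forall>u. u \<rightarrow>\<^sup>*\<^bsub>?G\<^esub> (u + x)}"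
  have "u \<rightarrow>\<^sup>*\<^bsub>?G\<^esub> u" for u by (rule S.reachable_refl) (simp only: verts UNIV_I)
  then have zero: "0 \<in> V" by (simp add: V_def)
  have gen: "x \<in> V" if "x ^ N = 1" for x
  proof -
    have "(u, u + x) \<in> parcs (GPaley \<omega> k)" for u using that by (simp add: mem_GPaley_arcs)
    then have "u \<rightarrow>\<^bsub>?G\<^esub> (u + x)" for u by (force simp: parcs_mk_symmetric)
    then show ?thesis by (simp add: V_def)
  qed
  have add: "x + y \<in> V" if "x \<in> V" "y \<in> V" for x y
    using that unfolding V_def by (auto simp: add.assoc[symmetric] intro: S.reachable_trans)
  \<comment> \<open>Since \<open>\<omega>\<close> has order \<open>k * N\<close>, the first
    \<open>N\<close> powers of \<open>\<omega> ^ k\<close> are distinct. Adding 0 yields the strict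
    inequality \<open>N < card V\<close>.\<close>
  have inj: "inj_on (\<lambda>i. \<omega> ^ (i * k)) {..<N}"
  proof (rule linorder_inj_onI)
    fix i j assume ij: "i < j" "i \<in> {..<N}" "j \<in> {..<N}"
    show "\<omega> ^ (i * k) \<noteq> \<omega> ^ (j * k)"
    proof
      assume eq: "\<omega> ^ (i * k) = \<omega> ^ (j * k)"
      have "\<omega> ^ (j * k) = \<omega> ^ (i * k) * \<omega> ^ ((j - i) * k)"
        using ij by (simp add: power_add[symmetric] add_mult_distrib[symmetric])
      then have "\<omega> ^ ((j - i) * k) = 1"
        using eq primitive_element_nonzero[OF prim] by simp
      then have "N * k dvd (j - i) * k"
        using primitive_power_eq_1_iff[OF prim] Q_card Q_N by (metis mult.commute)
      then have "N dvd j - i" using k2 by simp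
      then show False using ij by (auto dest: dvd_imp_le)
    qed
  qed auto
  have "insert 0 ((\<lambda>i. \<omega> ^ (i * k)) ` {..<N}) \<subseteq> V"
    using zero gen S_eq by blast
  then have "card (insert 0 ((\<lambda>i. \<omega> ^ (i * k)) ` {..<N})) \<le> card V"
    by (intro card_mono) auto
  then have "N < card V"
    using primitive_element_nonzero[OF prim] card_image[OF inj] by (subst (asm) card_insert_disjoint) auto
  then have "V = UNIV"
    using N_ge by (intro additive_submonoid_eq_UNIV zero add) auto
  then have "\<forall>u x. u \<rightarrow>\<^sup>*\<^bsub>?G\<^esub> (u + x)" unfolding V_def by blast
  then have "u \<rightarrow>\<^sup>*\<^bsub>?G\<^esub> v" for u v
    by (metis add_diff_cancel_left' diff_add_cancel add.commute)
  then show ?thesis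
    unfolding Digraph_Component.connected_def strongly_connected_def verts by simp
qed

end

theorem theorem3p8:
  fixes p R k :: nat and \<omega> :: "'a::{field,finite}"
  assumes "prime p" and "R \<ge> 1" and "CARD('a) = p ^ R"
    and "k \<ge> 2" and "k dvd p - 1" and "odd p \<longrightarrow> 2 * k dvd p ^ R - 1"
    and "primitive_element \<omega>"
  shows "Digraph_Component.connected (with_proj (GPaley \<omega> k))
    \<and> internal_semidirect (BijGroup UNIV) (graph_Aut (GPaley \<omega> k))
        translation_group (generate (BijGroup UNIV) {mult_map (\<omega> ^ k), frobenius p})
    \<and> subgroup (graph_Aut (GPaley \<omega> k)) ((BijGroup UNIV)\<lparr>carrier := AGammaL1 p \<omega>\<rparr>)"
proof -
  interpret gpaley_field p R k \<omega> "p ^ R - 1" "(p - 1) div k" "(p ^ R - 1) div k"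
    using assms by unfold_locales auto
  interpret G: group "BijGroup (UNIV :: 'a set)" by (rule group_BijGroup)
  have semi: "internal_semidirect (BijGroup UNIV) (graph_Aut (GPaley \<omega> k))
      translation_group (generate (BijGroup UNIV) {mult_map (\<omega> ^ k), frobenius p})"
    unfolding graph_Aut_eq
    by (rule internal_semidirect_translation_group[OF subgroup_Lin Lin_bij_additive(2)])
  moreover have "subgroup (graph_Aut (GPaley \<omega> k)) ((BijGroup UNIV)\<lparr>carrier := AGammaL1 p \<omega>\<rparr>)"
  proof (rule G.subgroup_incl)
    show "subgroup (graph_Aut (GPaley \<omega> k)) (BijGroup UNIV)"
      using semi by (simp add: internal_semidirect_def)
    show "subgroup (AGammaL1 p \<omega>) (BijGroup UNIV)"
      using internal_semidirect_AGammaL1[OF assms(1,3,7)] by (simp add: internal_semidirect_def)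
    show "graph_Aut (GPaley \<omega> k) \<subseteq> AGammaL1 p \<omega>"
      unfolding graph_Aut_eq AGammaL1_def using Lin_subset by (auto simp: set_mult_def)
  qed
  ultimately show ?thesis using connected_GPaley by blast
qed

end
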